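(* Let $n$ be a positive odd integer and let $Q=(\mathbb{Z}_n,\circ)$, where $r\circ s=2s-r \bmod n$. Then $\mathrm{Mlt}_\lambda(Q)$ is a characteristic subgroup of $\mathrm{Mlt}(Q)$.
   Context: $\mathbb{Z}_n=\{0,1,\ldots,n-1\}$ denotes the integers modulo $n$. For odd $n$, $(\mathbb{Z}_n,\circ)$ is a quasigroup, i.e. for all $a,b$ the equations $a\circ x=b$ and $y\circ a=b$ have unique solutions. For $x\in Q$ the right and left translations are the permutations $R_x: y\mapsto y\circ x$ and $L_x: y\mapsto x\circ y$ of $Q$. The left multiplication group is $\mathrm{Mlt}_\lambda(Q)=\langle L_x\mid x\in Q\rangle$, the right multiplication group is $\mathrm{Mlt}_\rho(Q)=\langle R_x \mid x\in Q\rangle$, and the multiplication group is $\mathrm{Mlt}(Q)=\langle \mathrm{Mlt}_\lambda(Q),\mathrm{Mlt}_\rho(Q)\rangle$, all subgroups of the symmetric group on $Q$. *)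

theory Defs
  imports "HOL-Algebra.Bij" "HOL-Algebra.Generated_Groups"
begin

text \<open>A magma is given by a carrier set \<open>Q\<close> and an operation \<open>f\<close>, of which only the
  values on \<open>Q\<close> matter. The symmetric group on \<open>Q\<close> is the library's \<^const>\<open>BijGroup\<close>, whose
  elements are extensional functions; hence the translations are restricted to \<open>Q\<close>.\<close>

definition quasigroup :: "'a set \<Rightarrow> ('a \<Rightarrow> 'a \<Rightarrow> 'a) \<Rightarrow> bool" where
  "quasigroup Q f \<longleftrightarrow>
     (\<forall>a\<in>Q. \<forall>b\<in>Q. f a b \<in> Q) \<and>
     (\<forall>a\<in>Q. \<forall>b\<in>Q. \<exists>!x. x \<in> Q \<and> f a x = b) \<and>
     (\<forall>a\<in>Q. \<forall>b\<in>Q. \<exists>!y. y \<in> Q \<and> f y a = b)"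

definition left_translation :: "'a set \<Rightarrow> ('a \<Rightarrow> 'a \<Rightarrow> 'a) \<Rightarrow> 'a \<Rightarrow> ('a \<Rightarrow> 'a)" where
  "left_translation Q f x = (\<lambda>y\<in>Q. f x y)"

definition right_translation :: "'a set \<Rightarrow> ('a \<Rightarrow> 'a \<Rightarrow> 'a) \<Rightarrow> 'a \<Rightarrow> ('a \<Rightarrow> 'a)" where
  "right_translation Q f x = (\<lambda>y\<in>Q. f y x)"

definition Mlt_left :: "'a set \<Rightarrow> ('a \<Rightarrow> 'a \<Rightarrow> 'a) \<Rightarrow> ('a \<Rightarrow> 'a) set" where
  "Mlt_left Q f = generate (BijGroup Q) (left_translation Q f ` Q)"

definition Mlt_right :: "'a set \<Rightarrow> ('a \<Rightarrow> 'a \<Rightarrow> 'a) \<Rightarrow> ('a \<Rightarrow> 'a) set" where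
  "Mlt_right Q f = generate (BijGroup Q) (right_translation Q f ` Q)"

definition Mlt :: "'a set \<Rightarrow> ('a \<Rightarrow> 'a \<Rightarrow> 'a) \<Rightarrow> ('a \<Rightarrow> 'a) set" where
  "Mlt Q f = generate (BijGroup Q) (Mlt_left Q f \<union> Mlt_right Q f)"

definition Mlt_group :: "'a set \<Rightarrow> ('a \<Rightarrow> 'a \<Rightarrow> 'a) \<Rightarrow> ('a \<Rightarrow> 'a) monoid" where
  "Mlt_group Q f = (BijGroup Q)\<lparr>carrier := Mlt Q f\<rparr>"

definition characteristic_subgroup :: "'a set \<Rightarrow> ('a, 'b) monoid_scheme \<Rightarrow> bool" where
  "characteristic_subgroup H G \<longleftrightarrow> subgroup H G \<and> (\<forall>\<phi>\<in>auto G. \<phi> ` H = H)"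

definition Zn :: "int \<Rightarrow> int set" where
  "Zn n = {0..<n}"

definition circ :: "int \<Rightarrow> int \<Rightarrow> int \<Rightarrow> int" where
  "circ n r s = (2 * s - r) mod n"

text \<open>\<^const>\<open>generate\<close> is only meaningful on subsets of the carrier; the following facts
  ensure this for the translations of a quasigroup.\<close>

lemma left_translation_Bij:
  assumes "quasigroup Q f" "x \<in> Q"
  shows "left_translation Q f x \<in> Bij Q"
proof -
  have "bij_betw (f x) Q Q"
  proof (rule bij_betwI')
    fix y z assume "y \<in> Q" "z \<in> Q"
    then have "\<exists>!w. w \<in> Q \<and> f x w = f x y" "f x y \<in> Q"
      using assms by (simp_all add: quasigroup_def)
    then show "(f x y = f x z) = (y = z)"
      using \<open>y \<in> Q\<close> \<open>z \<in> Q\<close> by metis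
  next
    fix y assume "y \<in> Q"
    then show "f x y \<in> Q" using assms by (simp add: quasigroup_def)
  next
    fix b assume "b \<in> Q"
    then have "\<exists>!w. w \<in> Q \<and> f x w = b"
      using assms by (simp add: quasigroup_def)
    then show "\<exists>w\<in>Q. b = f x w" by metis
  qed
  then show ?thesis
    by (simp add: Bij_def left_translation_def cong: bij_betw_cong)
qed

lemma right_translation_Bij:
  assumes "quasigroup Q f" "x \<in> Q"
  shows "right_translation Q f x \<in> Bij Q"
proof -
  have "bij_betw (\<lambda>y. f y x) Q Q"
  proof (rule bij_betwI')
    fix y z assume "y \<in> Q" "z \<in> Q"
    then have "\<exists>!w. w \<in> Q \<and> f w x = f y x" "f y x \<in> Q"
      using assms by (simp_all add: quasigroup_def)
    then show "(f y x = f z x) = (y = z)"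
      using \<open>y \<in> Q\<close> \<open>z \<in> Q\<close> by metis
  next
    fix y assume "y \<in> Q"
    then show "f y x \<in> Q" using assms by (simp add: quasigroup_def)
  next
    fix b assume "b \<in> Q"
    then have "\<exists>!w. w \<in> Q \<and> f w x = b"
      using assms by (simp add: quasigroup_def)
    then show "\<exists>w\<in>Q. b = f w x" by metis
  qed
  then show ?thesis
    by (simp add: Bij_def right_translation_def cong: bij_betw_cong)
qed

lemma Mlt_left_subgroup:
  assumes "quasigroup Q f"
  shows "subgroup (Mlt_left Q f) (BijGroup Q)"
  unfolding Mlt_left_def
  using left_translation_Bij[OF assms]
  by (intro group.generate_is_subgroup group_BijGroup) (auto simp: BijGroup_def)

lemma Mlt_right_subgroup:
  assumes "quasigroup Q f"
  shows "subgroup (Mlt_right Q f) (BijGroup Q)"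
  unfolding Mlt_right_def
  using right_translation_Bij[OF assms]
  by (intro group.generate_is_subgroup group_BijGroup) (auto simp: BijGroup_def)

lemma Mlt_subgroup:
  assumes "quasigroup Q f"
  shows "subgroup (Mlt Q f) (BijGroup Q)"
  unfolding Mlt_def
  using Mlt_left_subgroup[OF assms] Mlt_right_subgroup[OF assms]
  by (intro group.generate_is_subgroup group_BijGroup) (auto dest: subgroup.subset)

lemma group_Mlt_group:
  assumes "quasigroup Q f"
  shows "group (Mlt_group Q f)"
  unfolding Mlt_group_def
  by (intro subgroup.subgroup_is_group Mlt_subgroup assms group_BijGroup)

lemma quasigroup_circ:
  fixes n :: int
  assumes "n > 0" "odd n"
  shows "quasigroup (Zn n) (circ n)"
  unfolding quasigroup_def
proof (intro conjI ballI)
  fix a b assume ab: "a \<in> Zn n" "b \<in> Zn n"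
  show "circ n a b \<in> Zn n" using assms by (simp add: circ_def Zn_def)
  have b: "b mod n = b" using ab by (simp add: Zn_def)
  obtain k where k: "n = 2 * k + 1" using assms(2) by (elim oddE)
  show "\<exists>!x. x \<in> Zn n \<and> circ n a x = b"
  proof (intro ex1I conjI)
    let ?x = "((k + 1) * (a + b)) mod n"
    show "?x \<in> Zn n" using assms by (simp add: Zn_def)
    have "circ n a ?x = (2 * ((k + 1) * (a + b)) - a) mod n"
      unfolding circ_def by (metis mod_diff_left_eq mod_mult_right_eq)
    also have "2 * ((k + 1) * (a + b)) - a = b + n * (a + b)"
      by (simp add: k algebra_simps)
    finally show "circ n a ?x = b" using b by simp
    fix y assume y: "y \<in> Zn n \<and> circ n a y = b"
    have "y = (k + 1) * (a + (2 * y - a)) + n * (- y)"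
      by (simp add: k algebra_simps)
    then have "y mod n = ((k + 1) * (a + (2 * y - a))) mod n"
      by (metis mod_mult_self2)
    also have "\<dots> = ((k + 1) * (a + (2 * y - a) mod n)) mod n"
      by (metis mod_add_right_eq mod_mult_right_eq)
    also have "(2 * y - a) mod n = b" using y by (simp add: circ_def)
    finally show "y = ?x" using y by (simp add: Zn_def)
  qed
  show "\<exists>!y. y \<in> Zn n \<and> circ n y a = b"
  proof (intro ex1I conjI)
    let ?x = "(2 * a - b) mod n"
    show "?x \<in> Zn n" using assms by (simp add: Zn_def)
    show "circ n ?x a = b" unfolding circ_def by (simp add: mod_diff_right_eq b)
    fix y assume y: "y \<in> Zn n \<and> circ n y a = b"
    have "y mod n = (2 * a - (2 * a - y) mod n) mod n" by (simp add: mod_diff_right_eq)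
    also have "(2 * a - y) mod n = b" using y by (simp add: circ_def)
    finally show "y = ?x" using y by (simp add: Zn_def)
  qed
qed

end

theory Submission
  imports Defs
begin

text \<open>
  The translations of \<open>(\<int>\<^sub>n, \<circ>)\<close> are affine maps: \<open>L\<^sub>x\<close> is \<open>y \<mapsto> 2y - x\<close> and \<open>R\<^sub>x\<close> is
  \<open>y \<mapsto> -y + 2x\<close>. Let \<open>t\<close> be the shift \<open>y \<mapsto> y + 1\<close>. Among affine permutations the powers of \<open>t\<close> are
  exactly the maps that commute with \<open>t\<close>, and they contain all commutators, since the linear
  coefficients commute. Moreover \<open>t\<close> is itself the commutator of \<open>L\<^sub>0\<close> and \<open>t\<close>, because
  \<open>2 - 1 = 1\<close>, and \<open>t\<close> lies in the left multiplication group, being a quotient of two left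
  translations.

  Hence the cyclic group \<open>\<langle>t\<rangle>\<close> is the derived subgroup of the multiplication group \<open>G\<close> and is its
  own centralizer. In any such group an automorphism \<open>\<phi>\<close> moves every element only within
  its coset of \<open>\<langle>t\<rangle>\<close>: as \<open>g\<close> acts on the cyclic group \<open>\<langle>t\<rangle>\<close> by a power map, and power maps commute with
  \<open>\<phi>\<close>, both \<open>g\<close> and \<open>\<phi> g\<close> act on \<open>\<langle>t\<rangle>\<close> in the same way, so that they differ by an element that
  centralizes \<open>\<langle>t\<rangle>\<close>. Consequently every subgroup of \<open>G\<close> above \<open>\<langle>t\<rangle>\<close> is characteristic
  (lemma \<open>characteristic_above_self_centralizing_commutators\<close>).
\<close>

section \<open>Subgroups above a self-centralizing cyclic derived subgroup\<close>

text \<open>The commutator conditions are written as \<open>xy = z(yx)\<close> instead of \<open>[x, y] = z\<close>, which keeps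
  inverses out of the computations with affine maps. The first one says that \<open>\<langle>t\<rangle>\<close> is
  normal with abelian quotient; together with the second one it makes \<open>\<langle>t\<rangle>\<close> the derived
  subgroup, so that automorphisms preserve it.\<close>

lemma (in group) characteristic_above_self_centralizing_commutators:
  assumes commutators: "\<And>x y. x \<in> carrier G \<Longrightarrow> y \<in> carrier G \<Longrightarrow>
      \<exists>k::nat. x \<otimes> y = t [^] k \<otimes> (y \<otimes> x)"
    and commutator: "\<exists>x\<in>carrier G. \<exists>y\<in>carrier G. x \<otimes> y = t \<otimes> (y \<otimes> x)"
    and self_centralizing: "\<And>c. c \<in> carrier G \<Longrightarrow> c \<otimes> t = t \<otimes> c \<Longrightarrow> \<exists>k::nat. c = t [^] k"
    and H: "subgroup H G" "t \<in> H"
  shows "characteristic_subgroup H G"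
proof -
  have t: "t \<in> carrier G" using H by (rule subgroup.mem_carrier)
  have powH: "t [^] k \<in> H" for k :: nat
    using H by (induction k) (simp_all add: subgroup.m_closed subgroup.one_closed)
  have coset: "\<exists>d\<in>H. \<phi> g = g \<otimes> d" if \<phi>: "\<phi> \<in> auto G" and g: "g \<in> carrier G" for \<phi> g
  proof -
    have hom: "\<phi> \<in> hom G G" and bij: "bij_betw \<phi> (carrier G) (carrier G)"
      using \<phi> by (auto simp: auto_def Bij_def)
    have cl: "\<phi> x \<in> carrier G" if "x \<in> carrier G" for x
      using hom that by (rule hom_in_carrier)
    have mult: "\<phi> (x \<otimes> y) = \<phi> x \<otimes> \<phi> y" if "x \<in> carrier G" "y \<in> carrier G" for x y
      using hom that by (rule hom_mult)
    interpret \<phi>: group_hom G G \<phi> by unfold_locales (rule hom)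
    have pow: "\<phi> (t [^] k) = \<phi> t [^] k" for k :: nat
      using t by (rule \<phi>.hom_nat_pow)
    obtain u :: nat where u: "\<phi> t = t [^] u"
    proof -
      obtain x y where xy: "x \<in> carrier G" "y \<in> carrier G" "x \<otimes> y = t \<otimes> (y \<otimes> x)"
        using commutator by blast
      have "\<phi> x \<otimes> \<phi> y = \<phi> t \<otimes> (\<phi> y \<otimes> \<phi> x)"
        using arg_cong[OF xy(3), of \<phi>] xy(1,2) t by (simp add: mult)
      moreover obtain k :: nat where "\<phi> x \<otimes> \<phi> y = t [^] k \<otimes> (\<phi> y \<otimes> \<phi> x)"
        using commutators xy cl by blast
      ultimately have "\<phi> t = t [^] k"
        using xy(1,2) t cl by simp
      then show thesis by (rule that)
    qed
    obtain a :: nat where a: "g \<otimes> t = t [^] a \<otimes> g"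
    proof -
      obtain k :: nat where "g \<otimes> t = t [^] k \<otimes> (t \<otimes> g)"
        using commutators g t by blast
      then have "g \<otimes> t = t [^] Suc k \<otimes> g"
        using g t by (simp add: m_assoc)
      then show thesis by (rule that)
    qed
    have act: "g \<otimes> t [^] m = (t [^] a) [^] m \<otimes> g" for m :: nat
    proof (induction m)
      case (Suc m)
      have "g \<otimes> t [^] Suc m = (g \<otimes> t [^] m) \<otimes> t" using g t by (simp add: m_assoc)
      also have "\<dots> = (t [^] a) [^] m \<otimes> (g \<otimes> t)" using Suc g t by (simp add: m_assoc)
      also have "\<dots> = (t [^] a) [^] Suc m \<otimes> g" using a g t by (simp add: m_assoc)
      finally show ?case .
    qed (use g t in simp)
    have act': "g \<otimes> \<phi> t = \<phi> t [^] a \<otimes> g"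
      using act[of u] t by (simp add: u nat_pow_pow mult.commute)
    define d where "d = inv g \<otimes> \<phi> g"
    have d: "d \<in> carrier G" "\<phi> g = g \<otimes> d"
      using g cl by (auto simp: d_def m_assoc[symmetric])
    have "g \<otimes> (d \<otimes> \<phi> t) = \<phi> g \<otimes> \<phi> t"
      unfolding d(2) using d(1) g t cl by (simp add: m_assoc)
    also have "\<dots> = \<phi> (g \<otimes> t)" using g t by (simp add: mult)
    also have "\<dots> = \<phi> t [^] a \<otimes> \<phi> g" using g t by (simp add: a mult pow)
    also have "\<dots> = (\<phi> t [^] a \<otimes> g) \<otimes> d"
      unfolding d(2) using d(1) g t cl by (simp add: m_assoc)
    also have "\<dots> = g \<otimes> (\<phi> t \<otimes> d)"
      unfolding act'[symmetric] using d(1) g t cl by (simp add: m_assoc)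
    finally have "d \<otimes> \<phi> t = \<phi> t \<otimes> d"
      using d(1) g t cl by simp
    \<comment> \<open>So \<open>d\<close> centralizes \<open>\<phi> t\<close>. Pulling \<open>d\<close> back along \<open>\<phi>\<close> gives an element that centralizes \<open>t\<close>,
      which avoids showing that \<open>\<phi> t\<close> generates \<open>\<langle>t\<rangle>\<close>.\<close>
    moreover obtain c where c: "c \<in> carrier G" "\<phi> c = d"
      using d bij by (metis bij_betw_imp_surj_on imageE)
    ultimately have "\<phi> (c \<otimes> t) = \<phi> (t \<otimes> c)" using t by (simp add: mult)
    then have "c \<otimes> t = t \<otimes> c"
      using c t bij by (meson bij_betw_imp_inj_on inj_onD m_closed)
    then obtain m :: nat where "c = t [^] m" using self_centralizing c by blast
    then have "d = t [^] (u * m)" using c pow u t by (simp add: nat_pow_pow)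
    then show ?thesis using powH d by auto
  qed
  have "\<phi> ` H = H" if \<phi>: "\<phi> \<in> auto G" for \<phi>
  proof
    show "\<phi> ` H \<subseteq> H"
    proof (rule image_subsetI)
      fix h assume h: "h \<in> H"
      have "h \<in> carrier G" using H(1) h by (rule subgroup.mem_carrier)
      then obtain d where "d \<in> H" "\<phi> h = h \<otimes> d" using coset[OF \<phi>] by blast
      then show "\<phi> h \<in> H" using H h by (simp add: subgroup.m_closed)
    qed
  next
    show "H \<subseteq> \<phi> ` H"
    proof
      fix h assume h: "h \<in> H"
      have "h \<in> carrier G" using H(1) h by (rule subgroup.mem_carrier)
      moreover have "\<phi> ` carrier G = carrier G"
        using \<phi> by (simp add: auto_def Bij_def bij_betw_def)
      ultimately obtain g where g: "g \<in> carrier G" "\<phi> g = h" by (metis imageE)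
      then obtain d where d: "d \<in> H" "h = g \<otimes> d" using coset[OF \<phi>] by blast
      moreover have "d \<in> carrier G" using H(1) d(1) by (rule subgroup.mem_carrier)
      ultimately have "g = h \<otimes> inv d"
        using g(1) by (simp add: m_assoc)
      then have "g \<in> H" using H(1) h d(1) by (simp add: subgroup.m_closed subgroup.m_inv_closed)
      then show "h \<in> \<phi> ` H" using g by blast
    qed
  qed
  then show ?thesis using H by (simp add: characteristic_subgroup_def)
qed

section \<open>Affine permutations modulo n\<close>

lemma Mlt_left_subset_Mlt: "Mlt_left Q f \<subseteq> Mlt Q f"
  unfolding Mlt_def by (meson Un_iff generate.incl subsetI)

definition affine_map :: "int \<Rightarrow> int \<Rightarrow> int \<Rightarrow> int \<Rightarrow> int" where
  "affine_map n a b = (\<lambda>y\<in>Zn n. (a * y + b) mod n)"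

text \<open>The linear coefficient is a unit modulo \<open>n\<close>. This is expressed by an inverse \<open>a'\<close> rather
  than by coprimality, because the inverse permutation is written down in terms of \<open>a'\<close>.\<close>

definition affine_bijections :: "int \<Rightarrow> (int \<Rightarrow> int) set" where
  "affine_bijections n = {affine_map n a b | a b. \<exists>a'. (a * a') mod n = 1 mod n}"

lemma affine_map_cong:
  assumes "a mod n = c mod n" "b mod n = d mod n"
  shows "affine_map n a b = affine_map n c d"
  unfolding affine_map_def
  by (rule restrict_ext) (metis assms mod_add_cong mod_mult_cong)

lemma left_translation_circ: "left_translation (Zn n) (circ n) x = affine_map n 2 (- x)"
  by (simp add: left_translation_def affine_map_def circ_def)

lemma right_translation_circ: "right_translation (Zn n) (circ n) x = affine_map n (- 1) (2 * x)"
  by (simp add: right_translation_def affine_map_def circ_def)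

context
  fixes n :: int
  assumes n: "n > 0"
begin

lemma compose_affine_map:
  "compose (Zn n) (affine_map n a b) (affine_map n c d) = affine_map n (a * c) (a * d + b)"
proof -
  have "(a * ((c * y + d) mod n) + b) mod n = (a * c * y + (a * d + b)) mod n" for y
  proof -
    have "(a * ((c * y + d) mod n) + b) mod n = (a * (c * y + d) + b) mod n"
      by (metis mod_add_left_eq mod_mult_right_eq)
    then show ?thesis by (simp add: algebra_simps)
  qed
  then show ?thesis
    using n by (auto simp: compose_def affine_map_def Zn_def restrict_def)
qed

lemma affine_map_id: "affine_map n 1 0 = (\<lambda>y\<in>Zn n. y)"
  unfolding affine_map_def by (rule restrict_ext) (simp add: Zn_def)

lemma affine_map_inverse:
  assumes "(a * a') mod n = 1 mod n"
  shows "compose (Zn n) (affine_map n a' (- (a' * b))) (affine_map n a b) = (\<lambda>y\<in>Zn n. y)"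
    and "compose (Zn n) (affine_map n a b) (affine_map n a' (- (a' * b))) = (\<lambda>y\<in>Zn n. y)"
proof -
  have "affine_map n (a' * a) (a' * b + - (a' * b)) = affine_map n 1 0"
    using assms by (intro affine_map_cong) (simp_all add: mult.commute)
  then show "compose (Zn n) (affine_map n a' (- (a' * b))) (affine_map n a b) = (\<lambda>y\<in>Zn n. y)"
    by (simp add: compose_affine_map affine_map_id)
  have "(a * - (a' * b) + b) mod n = (b - (a * a') * b) mod n" by (simp add: algebra_simps)
  also have "\<dots> = (b - 1 * b) mod n" using assms by (metis mod_diff_right_eq mod_mult_left_eq)
  finally have "affine_map n (a * a') (a * - (a' * b) + b) = affine_map n 1 0"
    using assms by (intro affine_map_cong) simp_all
  then show "compose (Zn n) (affine_map n a b) (affine_map n a' (- (a' * b))) = (\<lambda>y\<in>Zn n. y)"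
    by (simp add: compose_affine_map affine_map_id)
qed

lemma affine_map_Bij:
  assumes "(a * a') mod n = 1 mod n"
  shows "affine_map n a b \<in> Bij (Zn n)"
proof -
  let ?f = "affine_map n a b" and ?g = "affine_map n a' (- (a' * b))"
  have "bij_betw ?f (Zn n) (Zn n)"
  proof (rule bij_betw_byWitness[where f' = ?g])
    show "\<forall>y\<in>Zn n. ?g (?f y) = y" "\<forall>y\<in>Zn n. ?f (?g y) = y"
      using affine_map_inverse[OF assms, of b] by (metis compose_eq restrict_apply')+
    show "?f ` Zn n \<subseteq> Zn n" "?g ` Zn n \<subseteq> Zn n"
      using n by (auto simp: affine_map_def Zn_def)
  qed
  then show ?thesis by (simp add: Bij_def affine_map_def)
qed

lemma affine_bijections_subset_Bij: "affine_bijections n \<subseteq> Bij (Zn n)"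
  using affine_map_Bij by (auto simp: affine_bijections_def)

lemma affine_bijections_subgroup: "subgroup (affine_bijections n) (BijGroup (Zn n))"
proof (rule group.subgroupI[OF group_BijGroup])
  show "affine_bijections n \<subseteq> carrier (BijGroup (Zn n))"
    using affine_bijections_subset_Bij by (simp add: BijGroup_def)
  show "affine_bijections n \<noteq> {}"
    unfolding affine_bijections_def by (auto intro!: exI[of _ 1])
next
  fix f assume f: "f \<in> affine_bijections n"
  then obtain a b a' where a: "f = affine_map n a b" "(a * a') mod n = 1 mod n"
    by (auto simp: affine_bijections_def)
  let ?g = "affine_map n a' (- (a' * b))"
  have a': "(a' * a) mod n = 1 mod n" using a by (simp add: mult.commute)
  have g: "?g \<in> affine_bijections n"
    using a' by (auto simp: affine_bijections_def)
  have "inv\<^bsub>BijGroup (Zn n)\<^esub> f = ?g"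
    using f g affine_bijections_subset_Bij affine_map_inverse(1)[OF a(2)]
    by (intro group.inv_equality[OF group_BijGroup]) (auto simp: BijGroup_def a(1))
  then show "inv\<^bsub>BijGroup (Zn n)\<^esub> f \<in> affine_bijections n" using g by simp
next
  fix f g assume fg: "f \<in> affine_bijections n" "g \<in> affine_bijections n"
  then obtain a b a' c d c' where
    f: "f = affine_map n a b" "(a * a') mod n = 1 mod n" and
    g: "g = affine_map n c d" "(c * c') mod n = 1 mod n"
    by (auto simp: affine_bijections_def)
  have "((a * c) * (a' * c')) mod n = ((a * a') * (c * c')) mod n"
    by (simp add: mult.assoc mult.left_commute)
  also have "\<dots> = (1 * 1) mod n" using f(2) g(2) by (rule mod_mult_cong)
  finally have "((a * c) * (a' * c')) mod n = 1 mod n" by simp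
  then have "compose (Zn n) f g \<in> affine_bijections n"
    unfolding f(1) g(1) compose_affine_map affine_bijections_def by blast
  then show "f \<otimes>\<^bsub>BijGroup (Zn n)\<^esub> g \<in> affine_bijections n"
    using fg affine_bijections_subset_Bij by (auto simp: BijGroup_def)
qed

lemma Mlt_circ_subset_affine_bijections:
  assumes "odd n"
  shows "Mlt (Zn n) (circ n) \<subseteq> affine_bijections n"
proof -
  obtain k where k: "n = 2 * k + 1" using assms by (elim oddE)
  \<comment> \<open>Oddness makes \<open>2\<close> invertible; its inverse is \<open>(n + 1) / 2\<close>.\<close>
  have "2 * (k + 1) = 1 + n" by (simp add: k)
  then have "(2 * (k + 1)) mod n = 1 mod n" by (metis mod_add_self2)
  then have "left_translation (Zn n) (circ n) ` Zn n \<subseteq> affine_bijections n"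
    unfolding left_translation_circ affine_bijections_def by blast
  moreover have "(- 1 * - 1) mod n = 1 mod n" by simp
  then have "right_translation (Zn n) (circ n) ` Zn n \<subseteq> affine_bijections n"
    unfolding right_translation_circ affine_bijections_def by blast
  ultimately show ?thesis
    unfolding Mlt_def Mlt_left_def Mlt_right_def
    by (intro group.generate_subgroup_incl[OF group_BijGroup] affine_bijections_subgroup
        Un_least)
qed

lemma shift_in_Mlt_left:
  assumes "odd n"
  shows "affine_map n 1 1 \<in> Mlt_left (Zn n) (circ n)"
proof -
  let ?B = "BijGroup (Zn n)"
  interpret B: group ?B by (rule group_BijGroup)
  let ?L = "left_translation (Zn n) (circ n)"
  have Q: "quasigroup (Zn n) (circ n)" using n assms by (rule quasigroup_circ)
  have mem: "0 \<in> Zn n" "n - 1 \<in> Zn n" using n by (auto simp: Zn_def)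
  have L: "?L x \<in> Mlt_left (Zn n) (circ n)" if "x \<in> Zn n" for x
    unfolding Mlt_left_def using that by (blast intro: generate.incl)
  have C: "?L 0 \<in> Bij (Zn n)" "?L (n - 1) \<in> Bij (Zn n)"
    using left_translation_Bij[OF Q] mem by auto
  have s: "affine_map n 1 1 \<in> Bij (Zn n)" by (rule affine_map_Bij[of _ 1]) simp
  \<comment> \<open>The shift is \<open>L\<^sub>n\<^sub>-\<^sub>1\<close> composed with the inverse of \<open>L\<^sub>0\<close>.\<close>
  have "(1::int) mod n = (1 - n) mod n" by simp
  then have "compose (Zn n) (affine_map n 1 1) (?L 0) = ?L (n - 1)"
    unfolding left_translation_circ compose_affine_map
    by (intro affine_map_cong) simp_all
  then have "affine_map n 1 1 \<otimes>\<^bsub>?B\<^esub> ?L 0 = ?L (n - 1)"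
    using s C by (simp add: BijGroup_def)
  then have "affine_map n 1 1 = ?L (n - 1) \<otimes>\<^bsub>?B\<^esub> inv\<^bsub>?B\<^esub> (?L 0)"
    using s C by (intro B.inv_solve_right[THEN iffD2]) (simp_all add: BijGroup_def)
  then show ?thesis
    using Mlt_left_subgroup[OF Q] L[OF mem(1)] L[OF mem(2)]
    by (simp add: subgroup.m_closed subgroup.m_inv_closed)
qed

end

section \<open>The left multiplication group\<close>

theorem lemma2p8:
  fixes n :: int
  assumes "n > 0" and "odd n"
  shows "characteristic_subgroup (Mlt_left (Zn n) (circ n)) (Mlt_group (Zn n) (circ n))"
proof -
  let ?G = "Mlt_group (Zn n) (circ n)" and ?H = "Mlt_left (Zn n) (circ n)"
  let ?M = "Mlt (Zn n) (circ n)"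
  let ?t = "affine_map n 1 1"
  note comp = compose_affine_map[OF assms(1)]
  have Q: "quasigroup (Zn n) (circ n)" using assms by (rule quasigroup_circ)
  interpret G: group ?G by (rule group_Mlt_group[OF Q])
  have M: "?M \<subseteq> affine_bijections n"
    using assms by (rule Mlt_circ_subset_affine_bijections)
  have carrier: "carrier ?G = ?M" by (simp add: Mlt_group_def)
  have mult: "f \<otimes>\<^bsub>?G\<^esub> g = compose (Zn n) f g" if "f \<in> ?M" "g \<in> ?M" for f g
    using that M affine_bijections_subset_Bij[OF assms(1)]
    by (auto simp: Mlt_group_def BijGroup_def)
  have affine: "\<exists>a b. f = affine_map n a b" if "f \<in> ?M" for f
    using that M unfolding affine_bijections_def by blast
  have tH: "?t \<in> ?H" using assms by (rule shift_in_Mlt_left)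
  have t: "?t \<in> ?M" using tH Mlt_left_subset_Mlt by blast
  have powM: "?t [^]\<^bsub>?G\<^esub> k \<in> ?M" for k :: nat
    using G.nat_pow_closed t by (simp add: carrier)
  have pow: "?t [^]\<^bsub>?G\<^esub> k = affine_map n 1 (int k)" for k :: nat
  proof (induction k)
    case 0
    show ?case by (simp add: Mlt_group_def BijGroup_def affine_map_id[OF assms(1)])
  next
    case (Suc k)
    have "?t [^]\<^bsub>?G\<^esub> Suc k = compose (Zn n) (?t [^]\<^bsub>?G\<^esub> k) ?t"
      using mult[OF powM t] by simp
    then show ?case using Suc by (simp add: comp add.commute)
  qed
  have shift: "affine_map n 1 b = ?t [^]\<^bsub>?G\<^esub> nat (b mod n)" for b
    unfolding pow using assms by (intro affine_map_cong) simp_all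
  show ?thesis
  proof (rule G.characteristic_above_self_centralizing_commutators[where t = ?t])
    fix f g assume fg: "f \<in> carrier ?G" "g \<in> carrier ?G"
    then obtain a b c d where f: "f = affine_map n a b" and g: "g = affine_map n c d"
      using affine[of f] affine[of g] unfolding carrier by blast
    let ?e = "(a * d + b) - (c * b + d)"
    have "f \<otimes>\<^bsub>?G\<^esub> g = affine_map n (a * c) (a * d + b)"
      using fg by (simp add: carrier mult) (simp add: f g comp)
    also have "\<dots> = compose (Zn n) (affine_map n 1 ?e) (compose (Zn n) g f)"
      by (simp add: f g comp mult.commute)
    also have "\<dots> = ?t [^]\<^bsub>?G\<^esub> nat (?e mod n) \<otimes>\<^bsub>?G\<^esub> (g \<otimes>\<^bsub>?G\<^esub> f)"
      using fg G.m_closed[of g f] by (simp only: shift[of ?e] carrier mult powM)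
    finally show "\<exists>k::nat. f \<otimes>\<^bsub>?G\<^esub> g = ?t [^]\<^bsub>?G\<^esub> k \<otimes>\<^bsub>?G\<^esub> (g \<otimes>\<^bsub>?G\<^esub> f)" by blast
  next
    let ?L = "left_translation (Zn n) (circ n) 0"
    have "0 \<in> Zn n" using assms by (simp add: Zn_def)
    then have "?L \<in> ?H" unfolding Mlt_left_def by (blast intro: generate.incl)
    then have L: "?L \<in> ?M" using Mlt_left_subset_Mlt by blast
    have "?L \<otimes>\<^bsub>?G\<^esub> ?t = ?t \<otimes>\<^bsub>?G\<^esub> (?t \<otimes>\<^bsub>?G\<^esub> ?L)"
      using L t G.m_closed[of ?t ?L]
      by (simp add: carrier mult) (simp add: left_translation_circ comp)
    then show "\<exists>x\<in>carrier ?G. \<exists>y\<in>carrier ?G. x \<otimes>\<^bsub>?G\<^esub> y = ?t \<otimes>\<^bsub>?G\<^esub> (y \<otimes>\<^bsub>?G\<^esub> x)"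
      using L t unfolding carrier by blast
  next
    fix c assume c: "c \<in> carrier ?G" "c \<otimes>\<^bsub>?G\<^esub> ?t = ?t \<otimes>\<^bsub>?G\<^esub> c"
    then obtain a b where ab: "c = affine_map n a b"
      using affine[of c] unfolding carrier by blast
    have "affine_map n a (a + b) = affine_map n a (b + 1)"
      using c t by (simp add: carrier mult) (simp add: ab comp)
    then have "affine_map n a (a + b) 0 = affine_map n a (b + 1) 0" by simp
    then have "(a + b) mod n = (b + 1) mod n"
      using assms by (simp add: affine_map_def Zn_def)
    then have "((a + b) - b) mod n = ((b + 1) - b) mod n" by (rule mod_diff_cong) simp
    then have "a mod n = 1 mod n" by simp
    then have "c = affine_map n 1 b" unfolding ab by (rule affine_map_cong) simp
    then show "\<exists>k::nat. c = ?t [^]\<^bsub>?G\<^esub> k"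
      using shift[of b] by (intro exI) (rule trans)
  next
    show "subgroup ?H ?G"
      unfolding Mlt_group_def
      using Mlt_left_subgroup[OF Q] Mlt_subgroup[OF Q] Mlt_left_subset_Mlt
      by (rule group.subgroup_incl[OF group_BijGroup])
  qed (rule tH)
qed

end
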